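(* Let $U,V$ be finite subsets of an abelian group $G$ with $|U|\le |V|$, and let $K,s$ be non-negative integers. If $\Gamma\subset U\times V$ is $(K,s)$-regular and $U\stackrel{\Gamma}{+} V\neq U+V$, then \[|U\stackrel{\Gamma}{+} V|\ge |V|+\frac{|U|}{2} -K-2s.\]
   Context: For $\Gamma\subset U\times V$, the restricted sumset is $U\stackrel{\Gamma}{+} V=\{u+v: (u,v)\in \Gamma\}$, and $U+V=\{u+v:u\in U,v\in V\}$. View $\Gamma$ as a bipartite graph between $U$ and $V$; $d_\Gamma(x)$ denotes the degree of a vertex $x$. For $x\in G$, $r_{U,V}(x)=|\{(u,v)\in U\times V: u+v=x\}|$. For non-negative integers $K,s$, $\Gamma$ is called $(K,s)$-regular if (i) $d_\Gamma(u)\ge |V|-s$ for each $u\in U$ and $d_\Gamma(v)\ge |U|-s$ for each $v\in V$, and (ii) every $c\in U+V$ with $r_{U,V}(c)\ge K$ belongs to $U\stackrel{\Gamma}{+}V$. *)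

theory Defs
  imports Complex_Main "HOL-Library.Set_Algebras"
begin

text \<open>The full sumset \<open>U + V\<close> is the elementwise sum of sets from \<open>Set_Algebras\<close>.\<close>

definition restricted_sumset ::
  "('a::ab_group_add) set \<Rightarrow> ('a \<times> 'a) set \<Rightarrow> 'a set \<Rightarrow> 'a set"
  where "restricted_sumset U \<Gamma> V = {u + v | u v. u \<in> U \<and> v \<in> V \<and> (u, v) \<in> \<Gamma>}"

text \<open>\<open>U\<close> and \<open>V\<close> may intersect as subsets of the group, while the two sides of the bipartite
  graph are disjoint copies; hence there is one degree function for each side.\<close>

definition degree_left :: "('a \<times> 'b) set \<Rightarrow> 'a \<Rightarrow> nat"
  where "degree_left \<Gamma> u = card {v. (u, v) \<in> \<Gamma>}"

definition degree_right :: "('a \<times> 'b) set \<Rightarrow> 'b \<Rightarrow> nat"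
  where "degree_right \<Gamma> v = card {u. (u, v) \<in> \<Gamma>}"

definition rep_count :: "('a::ab_group_add) set \<Rightarrow> 'a set \<Rightarrow> 'a \<Rightarrow> nat"
  where "rep_count U V x = card {(u, v). (u, v) \<in> U \<times> V \<and> u + v = x}"

definition regular_graph ::
  "nat \<Rightarrow> nat \<Rightarrow> ('a::ab_group_add) set \<Rightarrow> 'a set \<Rightarrow> ('a \<times> 'a) set \<Rightarrow> bool"
  where "regular_graph K s U V \<Gamma> \<longleftrightarrow>
    (\<forall>u\<in>U. int (degree_left \<Gamma> u) \<ge> int (card V) - int s) \<and>
    (\<forall>v\<in>V. int (degree_right \<Gamma> v) \<ge> int (card U) - int s) \<and>
    (\<forall>c \<in> U + V. rep_count U V c \<ge> K \<longrightarrow> c \<in> restricted_sumset U \<Gamma> V)"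

end

theory Submission
  imports Defs
begin

text \<open>
  A vertex \<open>u \<in> U\<close> misses at most \<open>s\<close> of its potential neighbours, so the restricted sumset
  contains all but \<open>s\<close> elements of \<open>u + V\<close>, and likewise all but \<open>s\<close> elements of \<open>v + U\<close>.
  Hence it suffices to find two translates, either \<open>u + V\<close> and \<open>v + U\<close>, or \<open>u + V\<close> and
  \<open>u' + V\<close>, whose union has at least \<open>|V| + |U|/2 - K\<close> elements.

  A missing sum \<open>c = u\<^sub>0 + v\<^sub>0\<close> has fewer than \<open>K\<close> representations; translate so that
  \<open>u\<^sub>0 = v\<^sub>0 = 0\<close>, and write \<open>n = |U|\<close>. If all unions of two translates are smaller than wanted,
  then every translate \<open>d + U\<close> with \<open>d \<in> V - U\<close> has more than \<open>n/2 + K\<close> elements in \<open>V\<close>,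
  while every shift of \<open>V\<close> by an element of \<open>U\<close> or \<open>-U\<close> leaves \<open>V\<close> in fewer than
  \<open>n/2 - K\<close> places. Consequently \<open>V - U\<close> is stable under subtracting elements of \<open>U\<close>. Let
  \<open>W = (V - U) - V\<close>. Counting the pairs \<open>(u, w) \<in> U \<times> W\<close> with \<open>u + w \<in> W\<close> from both sides gives
  \<open>n (|W| - n/2 + K) \<le> |W| (n/2 - K)\<close>. But \<open>W\<close> contains all but fewer than \<open>K\<close> elements of
  \<open>-U\<close>, which makes \<open>|W|\<close> too large for this.
\<close>

section \<open>Large unions of two translates\<close>

text \<open>The first bound rearranges to \<open>w * (n + 2 * k) \<le> n * (n - 2 * k)\<close>.
  Inserting \<open>w \<ge> n - k\<close> leaves \<open>3 * n \<le> 2 * k\<close>, against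
  \<open>2 * k < n\<close>.\<close>

lemma pair_count_bounds_incompatible:
  fixes n w k :: int
  assumes "n * (2 * w - n + 2 * k) \<le> w * (n - 2 * k)"
    and "n - k \<le> w" and "2 * k < n" and "0 < k"
  shows False
proof -
  have "w * (n + 2 * k) \<le> n * (n - 2 * k)"
    using assms(1) by (simp add: algebra_simps)
  moreover have "(n - k) * (n + 2 * k) \<le> w * (n + 2 * k)"
    using assms by (intro mult_right_mono) auto
  ultimately have "k * (3 * n) \<le> k * (2 * k)"
    by (simp add: algebra_simps)
  then show False
    using assms by simp
qed

lemma large_union_of_translates_at_zero:
  fixes U V :: "('a::ab_group_add) set"
  assumes fin: "finite U" "finite V" and zero: "0 \<in> U" "0 \<in> V"
    and rep: "rep_count U V 0 < K"
  shows "(\<exists>u\<in>U. \<exists>v\<in>V. 2 * card V + card U \<le> 2 * card ((+) u ` V \<union> (+) v ` U) + 2 * K) \<or>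
         (\<exists>u\<in>U. 2 * card V + card U \<le> 2 * card (V \<union> (+) u ` V) + 2 * K)"
proof (rule ccontr)
  assume neg: "\<not> ?thesis"
  then have mixed: "2 * card ((+) u ` V \<union> (+) v ` U) + 2 * K < 2 * card V + card U"
    if "u \<in> U" "v \<in> V" for u v
    using that by (meson not_le)
  have same: "2 * card (V \<union> (+) u ` V) + 2 * K < 2 * card V + card U" if "u \<in> U" for u
    using neg that by (meson not_le)
  define n where "n = card U"
  define D where "D = {v - u | v u. v \<in> V \<and> u \<in> U}"
  define W where "W = D - V"
  have "finite D"
    using finite_imageI[OF finite_cartesian_product[OF fin(2,1)], of "\<lambda>(v, u). v - u"]
    by (rule finite_subset[rotated]) (auto simp: D_def)
  then have finW: "finite W"
    by (simp add: W_def)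

  \<comment> \<open>For \<open>d = v - u\<close>, the map \<open>x \<mapsto> v + x\<close> carries
    these \<open>x\<close> onto the intersection of \<open>u + V\<close> and \<open>v + U\<close>,
    which is large by inclusion-exclusion because the union is small.\<close>
  have in_V: "n + 2 * K < 2 * card {x \<in> U. x + d \<in> V}" if "d \<in> D" for d
  proof -
    from that obtain v u where uv: "v \<in> V" "u \<in> U" "d = v - u"
      by (auto simp: D_def)
    have "(+) v ` {x \<in> U. x + d \<in> V} = (+) u ` V \<inter> (+) v ` U" (is "?L = ?R")
    proof
      show "?L \<subseteq> ?R"
      proof
        fix y assume "y \<in> ?L"
        then obtain x where "x \<in> U" "x + d \<in> V" "y = v + x" by auto
        moreover from this have "y = u + (x + d)" using uv by simp
        ultimately show "y \<in> ?R" by blast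
      qed
      show "?R \<subseteq> ?L"
      proof
        fix y assume "y \<in> ?R"
        then obtain x v' where *: "x \<in> U" "v' \<in> V" "y = v + x" "y = u + v'" by auto
        then have "u + (x + d) = u + v'" using uv(3) by simp
        then have "x + d = v'" by (rule add_left_imp_eq)
        with * show "y \<in> ?L" by auto
      qed
    qed
    moreover have "card ((+) v ` {x \<in> U. x + d \<in> V}) = card {x \<in> U. x + d \<in> V}"
      by (simp add: card_image)
    ultimately have "card {x \<in> U. x + d \<in> V} = card ((+) u ` V \<inter> (+) v ` U)"
      by simp
    moreover have "card ((+) u ` V) + card ((+) v ` U) =
        card ((+) u ` V \<union> (+) v ` U) + card ((+) u ` V \<inter> (+) v ` U)"
      using fin by (intro card_Un_Int) auto
    moreover have "card ((+) u ` V) = card V" "card ((+) v ` U) = card U"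
      by (simp_all add: card_image)
    ultimately show ?thesis
      using mixed[OF uv(2,1)] by (simp add: n_def)
  qed

  have shift_up: "2 * card {v \<in> V. u + v \<notin> V} + 2 * K < n" if "u \<in> U" for u
  proof -
    have "V \<union> (+) u ` V = V \<union> (+) u ` {v \<in> V. u + v \<notin> V}" by auto
    moreover have "card \<dots> = card V + card ((+) u ` {v \<in> V. u + v \<notin> V})"
      using fin by (intro card_Un_disjoint) auto
    ultimately show ?thesis
      using same[OF that] by (simp add: card_image n_def)
  qed

  \<comment> \<open>The same union as in \<open>shift_up\<close>, now split as \<open>u + V\<close>
    and the part of \<open>V\<close> outside it.\<close>
  have shift_down: "2 * card {v \<in> V. v - u \<notin> V} + 2 * K < n" if "u \<in> U" for u
  proof -
    have "V \<union> (+) u ` V = (+) u ` V \<union> {v \<in> V. v - u \<notin> V}"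
      (is "?L = ?R")
    proof
      show "?L \<subseteq> ?R"
      proof
        fix y assume "y \<in> ?L"
        moreover have "y = u + (y - u)" by simp
        ultimately show "y \<in> ?R" by blast
      qed
    qed auto
    moreover have "card \<dots> = card ((+) u ` V) + card {v \<in> V. v - u \<notin> V}"
      using fin by (intro card_Un_disjoint) auto
    ultimately show ?thesis
      using same[OF that] by (simp add: card_image n_def)
  qed

  \<comment> \<open>If \<open>d - u\<close> were not in \<open>D\<close>, each \<open>x + d\<close>
    in \<open>V\<close> would leave \<open>V\<close> on subtracting \<open>u\<close>, since
    otherwise \<open>d - u = (x + d - u) - x\<close>. By \<open>in_V\<close> these are more than
    \<open>shift_down\<close> allows.\<close>
  have stable: "d - u \<in> D" if "d \<in> D" "u \<in> U" for d u
  proof (rule ccontr)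
    assume no: "d - u \<notin> D"
    have "(\<lambda>x. x + d) ` {x \<in> U. x + d \<in> V} \<subseteq> {v \<in> V. v - u \<notin> V}"
    proof (rule image_subsetI)
      fix x assume "x \<in> {x \<in> U. x + d \<in> V}"
      then have x: "x \<in> U" "x + d \<in> V" by auto
      have "x + d - u \<notin> V"
      proof
        assume "x + d - u \<in> V"
        moreover have "d - u = (x + d - u) - x" by simp
        ultimately show False using x no unfolding D_def by blast
      qed
      with x show "x + d \<in> {v \<in> V. v - u \<notin> V}" by simp
    qed
    then have "card {x \<in> U. x + d \<in> V} \<le> card {v \<in> V. v - u \<notin> V}"
      using fin by (intro card_inj_on_le) auto
    then show False
      using in_V[OF that(1)] shift_down[OF that(2)] by simp
  qed

  \<comment> \<open>As \<open>w\<close> lies in \<open>D\<close>, \<open>in_V\<close> puts more than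
    \<open>n/2 + K\<close> of the sums \<open>u + w\<close> in \<open>V\<close>, which is disjoint
    from \<open>W\<close>.\<close>
  have per_w: "2 * card {u \<in> U. u + w \<in> W} + 2 * K \<le> n" if "w \<in> W" for w
  proof -
    have "card {u \<in> U. u + w \<in> W} + card {u \<in> U. u + w \<in> V}
        = card ({u \<in> U. u + w \<in> W} \<union> {u \<in> U. u + w \<in> V})"
      using fin by (intro card_Un_disjoint[symmetric]) (auto simp: W_def)
    also have "\<dots> \<le> n"
      unfolding n_def using fin by (intro card_mono) auto
    finally show ?thesis
      using in_V[of w] that by (simp add: W_def)
  qed

  \<comment> \<open>By stability \<open>w - u\<close> stays in \<open>D\<close>, so it is in
    \<open>W\<close> or is an element of \<open>V\<close> that leaves \<open>V\<close> on adding
    \<open>u\<close>; \<open>shift_up\<close> bounds the latter.\<close>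
  have per_u: "2 * card W + 2 * K \<le> 2 * card {w \<in> W. u + w \<in> W} + n" if "u \<in> U" for u
  proof -
    have "W \<subseteq> (+) u ` {w \<in> W. u + w \<in> W} \<union> (+) u ` {v \<in> V. u + v \<notin> V}"
    proof
      fix w assume w: "w \<in> W"
      then have "w - u \<in> D" using stable that by (auto simp: W_def)
      then have "w - u \<in> {w \<in> W. u + w \<in> W} \<union> {v \<in> V. u + v \<notin> V}"
        using w by (auto simp: W_def)
      then have "u + (w - u) \<in> (+) u ` ({w \<in> W. u + w \<in> W} \<union> {v \<in> V. u + v \<notin> V})"
        by (rule imageI)
      then show "w \<in> (+) u ` {w \<in> W. u + w \<in> W} \<union> (+) u ` {v \<in> V. u + v \<notin> V}"
        by (simp add: image_Un)
    qed
    then have "card W \<le> card ((+) u ` {w \<in> W. u + w \<in> W} \<union> (+) u ` {v \<in> V. u + v \<notin> V})"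
      using fin finW by (intro card_mono) auto
    also have "\<dots> \<le> card ((+) u ` {w \<in> W. u + w \<in> W}) + card ((+) u ` {v \<in> V. u + v \<notin> V})"
      by (rule card_Un_le)
    also have "\<dots> = card {w \<in> W. u + w \<in> W} + card {v \<in> V. u + v \<notin> V}"
      by (simp add: card_image)
    finally show ?thesis
      using shift_up[OF that] by simp
  qed

  have double_count: "(\<Sum>u\<in>U. card {w \<in> W. u + w \<in> W}) = (\<Sum>w\<in>W. card {u \<in> U. u + w \<in> W})"
    using fin finW by (intro sum_multicount_gen) auto
  have "int n * (2 * int (card W) - int n + 2 * int K)
      = (\<Sum>u\<in>U. 2 * int (card W) - int n + 2 * int K)"
    by (simp add: n_def)
  also have "\<dots> \<le> (\<Sum>u\<in>U. 2 * int (card {w \<in> W. u + w \<in> W}))"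
    using per_u by (intro sum_mono) fastforce
  also have "\<dots> = (\<Sum>w\<in>W. 2 * int (card {u \<in> U. u + w \<in> W}))"
    unfolding sum_distrib_left[symmetric] of_nat_sum[symmetric] double_count ..
  also have "\<dots> \<le> (\<Sum>w\<in>W. int n - 2 * int K)"
    using per_w by (intro sum_mono) fastforce
  also have "\<dots> = int (card W) * (int n - 2 * int K)"
    by simp
  finally have count:
    "int n * (2 * int (card W) - int n + 2 * int K) \<le> int (card W) * (int n - 2 * int K)" .

  have "{(u, v). (u, v) \<in> U \<times> V \<and> u + v = 0} = (\<lambda>u. (u, - u)) ` {u \<in> U. - u \<in> V}"
    by (auto simp: add_eq_0_iff)
  then have few: "card {u \<in> U. - u \<in> V} < K"
    using rep by (simp add: rep_count_def card_image inj_on_def)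
  \<comment> \<open>Since \<open>0 \<in> V\<close>, every \<open>- u\<close> is in \<open>D\<close>,
    hence in \<open>W\<close> unless it is in \<open>V\<close>; the exceptions correspond to
    representations of 0.\<close>
  have "U \<subseteq> {u \<in> U. - u \<in> V} \<union> uminus ` W"
  proof
    fix u assume u: "u \<in> U"
    then have "- u \<in> D"
      using zero by (force simp: D_def)
    show "u \<in> {u \<in> U. - u \<in> V} \<union> uminus ` W"
    proof (cases "- u \<in> V")
      case False
      with \<open>- u \<in> D\<close> have "- (- u) \<in> uminus ` W"
        by (intro imageI) (simp add: W_def)
      then show ?thesis by simp
    qed (use u in simp)
  qed
  then have "n \<le> card ({u \<in> U. - u \<in> V} \<union> uminus ` W)"
    unfolding n_def using fin finW by (intro card_mono) auto
  also have "\<dots> \<le> card {u \<in> U. - u \<in> V} + card (uminus ` W)"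
    by (rule card_Un_le)
  also have "card (uminus ` W) = card W"
    by (simp add: card_image)
  finally have "int n - int K \<le> int (card W)"
    using few by simp
  \<comment> \<open>At \<open>u = 0\<close> no element leaves \<open>V\<close>, so
    \<open>shift_up\<close> reduces to this inequality.\<close>
  moreover have "2 * int K < int n"
    using shift_up[OF zero(1)] by simp
  ultimately show False
    using pair_count_bounds_incompatible[OF count] few by simp
qed

text \<open>Replacing \<open>U\<close> by \<open>U - a\<close> and \<open>V\<close> by
  \<open>V - b\<close>, where \<open>c = a + b\<close>, moves \<open>c\<close> to 0. All translates
  \<open>u + V\<close> and \<open>v + U\<close> then move by the same \<open>- c\<close>, so their
  unions keep their size.\<close>

lemma large_union_of_translates:
  fixes U V :: "('a::ab_group_add) set"
  assumes fin: "finite U" "finite V" and c: "c \<in> U + V" and rep: "rep_count U V c < K"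
  shows "(\<exists>u\<in>U. \<exists>v\<in>V. 2 * card V + card U \<le> 2 * card ((+) u ` V \<union> (+) v ` U) + 2 * K) \<or>
         (\<exists>u\<in>U. \<exists>u'\<in>U. 2 * card V + card U \<le> 2 * card ((+) u ` V \<union> (+) u' ` V) + 2 * K)"
proof -
  obtain a b where ab: "a \<in> U" "b \<in> V" "c = a + b"
    using c by (auto elim: set_plus_elim)
  define U' V' where "U' = (\<lambda>x. x - a) ` U" and "V' = (\<lambda>x. x - b) ` V"
  have "{(u, v). (u, v) \<in> U' \<times> V' \<and> u + v = 0} =
      (\<lambda>(u, v). (u - a, v - b)) ` {(u, v). (u, v) \<in> U \<times> V \<and> u + v = c}"
    unfolding U'_def V'_def ab(3) by (auto simp: image_iff algebra_simps)
  then have rep': "rep_count U' V' 0 < K"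
    using rep unfolding rep_count_def by (simp add: card_image inj_on_def split_def prod_eq_iff)
  have cards: "card U' = card U" "card V' = card V"
    unfolding U'_def V'_def by (simp_all add: card_image inj_on_def)
  have fin': "finite U'" "finite V'" and zero: "0 \<in> U'" "0 \<in> V'"
    using fin ab unfolding U'_def V'_def by force+
  have shift: "card ((\<lambda>x. x - c) ` A) = card A" for A
    by (simp add: card_image inj_on_def)
  have V': "(+) (u - a) ` V' = (\<lambda>x. x - c) ` (+) u ` V" for u
    unfolding V'_def ab(3) image_image by (simp add: algebra_simps)
  have U': "(+) (v - b) ` U' = (\<lambda>x. x - c) ` (+) v ` U" for v
    unfolding U'_def ab(3) image_image by (simp add: algebra_simps)
  have mixed: "card ((+) (u - a) ` V' \<union> (+) (v - b) ` U') = card ((+) u ` V \<union> (+) v ` U)" for u v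
    unfolding U' V' image_Un[symmetric] by (rule shift)
  \<comment> \<open>\<open>V'\<close> itself corresponds to the translate \<open>a + V\<close>, so
    \<open>a\<close> serves as one of the two elements of \<open>U\<close>.\<close>
  have "V' = (\<lambda>x. x - c) ` (+) a ` V"
    using V'[of a] by simp
  then have same: "card (V' \<union> (+) (u - a) ` V') = card ((+) a ` V \<union> (+) u ` V)" for u
    unfolding V' by (metis image_Un shift)
  from large_union_of_translates_at_zero[OF fin' zero rep'] show ?thesis
  proof (elim disjE bexE)
    fix u' v'
    assume "u' \<in> U'" "v' \<in> V'"
      and large: "2 * card V' + card U' \<le> 2 * card ((+) u' ` V' \<union> (+) v' ` U') + 2 * K"
    then obtain u v where "u \<in> U" "v \<in> V" "u' = u - a" "v' = v - b"
      unfolding U'_def V'_def by blast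
    then show ?thesis
      using large unfolding cards by (metis mixed)
  next
    fix u'
    assume "u' \<in> U'"
      and large: "2 * card V' + card U' \<le> 2 * card (V' \<union> (+) u' ` V') + 2 * K"
    then obtain u where "u \<in> U" "u' = u - a"
      unfolding U'_def by blast
    then show ?thesis
      using large ab(1) unfolding cards by (metis same)
  qed
qed

section \<open>Elements of translates missed by the restricted sumset\<close>

lemma card_translate_left_minus_restricted_sumset:
  fixes U V :: "('a::ab_group_add) set"
  assumes fin: "finite U" "finite V" and sub: "\<Gamma> \<subseteq> U \<times> V" and reg: "regular_graph K s U V \<Gamma>"
    and u: "u \<in> U"
  shows "card ((+) u ` V - restricted_sumset U \<Gamma> V) \<le> s"
proof -
  have N: "{v. (u, v) \<in> \<Gamma>} \<subseteq> V" using sub by auto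
  have "(+) u ` V - restricted_sumset U \<Gamma> V \<subseteq> (+) u ` (V - {v. (u, v) \<in> \<Gamma>})"
    using u by (auto simp: restricted_sumset_def)
  then have "card ((+) u ` V - restricted_sumset U \<Gamma> V) \<le> card (V - {v. (u, v) \<in> \<Gamma>})"
    using fin by (intro surj_card_le) auto
  also have "\<dots> = card V - degree_left \<Gamma> u"
    using N fin by (simp add: card_Diff_subset finite_subset degree_left_def)
  also have "\<dots> \<le> s"
    using reg u by (fastforce simp: regular_graph_def)
  finally show ?thesis .
qed

lemma card_translate_right_minus_restricted_sumset:
  fixes U V :: "('a::ab_group_add) set"
  assumes fin: "finite U" "finite V" and sub: "\<Gamma> \<subseteq> U \<times> V" and reg: "regular_graph K s U V \<Gamma>"
    and v: "v \<in> V"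
  shows "card ((+) v ` U - restricted_sumset U \<Gamma> V) \<le> s"
proof -
  have N: "{u. (u, v) \<in> \<Gamma>} \<subseteq> U" using sub by auto
  have "(+) v ` U - restricted_sumset U \<Gamma> V \<subseteq> (+) v ` (U - {u. (u, v) \<in> \<Gamma>})"
    using v by (auto simp: restricted_sumset_def add.commute)
  then have "card ((+) v ` U - restricted_sumset U \<Gamma> V) \<le> card (U - {u. (u, v) \<in> \<Gamma>})"
    using fin by (intro surj_card_le) auto
  also have "\<dots> = card U - degree_right \<Gamma> v"
    using N fin by (simp add: card_Diff_subset finite_subset degree_right_def)
  also have "\<dots> \<le> s"
    using reg v by (fastforce simp: regular_graph_def)
  finally show ?thesis .
qed

text \<open>Source of the loss \<open>2 * s\<close>: each of the two translates has at most
  \<open>s\<close> elements outside the restricted sumset.\<close>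

lemma card_Un_le_of_card_Diff_le:
  assumes "finite S" "card (A - S) \<le> s" "card (B - S) \<le> s" "finite A" "finite B"
  shows "card (A \<union> B) \<le> card S + 2 * s"
proof -
  have "card (A \<union> B) \<le> card (S \<union> ((A - S) \<union> (B - S)))"
    using assms by (intro card_mono) auto
  also have "\<dots> \<le> card S + (card (A - S) + card (B - S))"
    by (meson add_left_mono card_Un_le order_trans)
  finally show ?thesis
    using assms by simp
qed

theorem theorem3p6:
  fixes U V :: "('a::ab_group_add) set"
    and \<Gamma> :: "('a \<times> 'a) set"
    and K s :: nat
  assumes "finite U" and "finite V"
    and "card U \<le> card V"
    and "\<Gamma> \<subseteq> U \<times> V"
    and "regular_graph K s U V \<Gamma>"
    and "restricted_sumset U \<Gamma> V \<noteq> U + V"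
  shows "real (card (restricted_sumset U \<Gamma> V)) \<ge>
           real (card V) + real (card U) / 2 - real K - 2 * real s"
proof -
  let ?S = "restricted_sumset U \<Gamma> V"
  have "?S \<subseteq> U + V"
    by (auto simp: restricted_sumset_def)
  then obtain c where c: "c \<in> U + V" "c \<notin> ?S"
    using assms(6) by blast
  then have rep: "rep_count U V c < K"
    using assms(5) by (meson not_le regular_graph_def)
  have "finite ?S"
    using \<open>?S \<subseteq> U + V\<close> finite_set_plus[OF assms(1,2)] finite_subset by blast
  note left = card_translate_left_minus_restricted_sumset[OF assms(1,2,4,5)]
    and right = card_translate_right_minus_restricted_sumset[OF assms(1,2,4,5)]
    and union = card_Un_le_of_card_Diff_le[OF \<open>finite ?S\<close>]
  from large_union_of_translates[OF assms(1,2) c(1) rep]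
  have "2 * card V + card U \<le> 2 * (card ?S + 2 * s) + 2 * K"
  proof (elim disjE bexE)
    fix u v
    assume "u \<in> U" "v \<in> V"
      and large: "2 * card V + card U \<le> 2 * card ((+) u ` V \<union> (+) v ` U) + 2 * K"
    then have "card ((+) u ` V \<union> (+) v ` U) \<le> card ?S + 2 * s"
      using assms by (intro union left right) auto
    then show ?thesis
      using large by simp
  next
    fix u u'
    assume "u \<in> U" "u' \<in> U"
      and large: "2 * card V + card U \<le> 2 * card ((+) u ` V \<union> (+) u' ` V) + 2 * K"
    then have "card ((+) u ` V \<union> (+) u' ` V) \<le> card ?S + 2 * s"
      using assms by (intro union left) auto
    then show ?thesis
      using large by simp
  qed
  then have "real (2 * card V + card U) \<le> real (2 * (card ?S + 2 * s) + 2 * K)"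
    by (rule of_nat_mono)
  then show ?thesis
    by simp
qed

end
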